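(* Let $q\in C[0,b]$ be complex valued and let $f$ be a solution of $f''=qf$ on $[0,b]$ with $f(0)=1$ and $f\neq0$ on $[0,b]$. Let $\mathbf{S}_N=\sum_{n=1}^N\beta_n\frac{\mathbf{s}_n}{n!}$ with complex numbers $\beta_1,\ldots,\beta_N$ (an $\mathbf{s}$-polynomial of order $N$). Then its coefficients are uniquely determined by the relations $$\beta_{j+1}=\gamma_1(\gamma_2\gamma_1)^j\mathbf{S}_N(0)+\sum_{\text{odd }n=1}^{j}\beta_n\,\gamma_1(\gamma_2\gamma_1)^{j-n}[1](0),\qquad j=0,1,2,\ldots,N-1.$$
   Context: Generalized derivatives: $\gamma_1g(x)=f^2(x)\frac{d}{dx}\left(\frac{g(x)}{f(x)}\right)$, $\gamma_2g(x)=\frac12\int_0^x\frac{g'(s)}{f(s)}ds$. The operator $\gamma_2\gamma_1$ is understood in the extended sense $\gamma_2\gamma_1g(x)=\frac12\left(g'(x)-g'(0)-\int_0^x q(s)g(s)\,ds\right)$ on $C^1[0,b]$ (which agrees with the composition for $g\in C^2[0,b]$). $(\gamma_2\gamma_1)^0$ is the identity and $(\gamma_2\gamma_1)^j$ is the $j$-fold iterate; $(\gamma_2\gamma_1)^j[1]$ is its action on the constant function $1$. Empty sums are $0$. Standing regularity convention: whenever a function $(\gamma_2\gamma_1)^i[1]$ occurs, $q$ is assumed regular enough for it to be well defined ($q\in W_2^{i-1}[0,b]$ for $i\ge1$), and for $\gamma_1(\gamma_2\gamma_1)^i[1](0)$ to exist. Functions $\varphi_k$: $X^{(0)}\equiv\widetilde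 X^{(0)}\equiv1$, $X^{(n)}(x)=n\int_0^x X^{(n-1)}(s)\left(f^2(s)\right)^{(-1)^n}ds$, $\widetilde X^{(n)}(x)=n\int_0^x \widetilde X^{(n-1)}(s)\left(f^2(s)\right)^{(-1)^{n-1}}ds$ for $n\ge1$; $\varphi_k=fX^{(k)}$ for $k$ odd, $\varphi_k=f\widetilde X^{(k)}$ for $k$ even. Then $\mathbf{s}_m(x)=\sum_{\text{odd }k=1}^m\binom mk x^k\varphi_{m-k}(x)$ for $m\ge1$. *)

theory Defs
  imports "HOL-Analysis.Analysis"
begin

text \<open>
  Functions on \<open>[0,b]\<close> are total functions \<open>real \<Rightarrow> complex\<close> of which only the values on
  \<open>{0..b}\<close> matter; all derivatives are taken within \<open>{0..b}\<close>, hence one-sided at the end points.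
\<close>

definition deriv_on :: "real \<Rightarrow> (real \<Rightarrow> complex) \<Rightarrow> real \<Rightarrow> complex" where
  "deriv_on b g x = vector_derivative g (at x within {0..b})"

definition schroedinger_solution :: "real \<Rightarrow> (real \<Rightarrow> complex) \<Rightarrow> (real \<Rightarrow> complex) \<Rightarrow> bool" where
  "schroedinger_solution b q f \<longleftrightarrow>
     (\<exists>f'. \<forall>x\<in>{0..b}. (f has_vector_derivative f' x) (at x within {0..b}) \<and>
                      (f' has_vector_derivative q x * f x) (at x within {0..b}))"

definition gamma1 :: "real \<Rightarrow> (real \<Rightarrow> complex) \<Rightarrow> (real \<Rightarrow> complex) \<Rightarrow> real \<Rightarrow> complex" where
  "gamma1 b f g x = (f x)\<^sup>2 * deriv_on b (\<lambda>t. g t / f t) x"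

definition gamma2 :: "real \<Rightarrow> (real \<Rightarrow> complex) \<Rightarrow> (real \<Rightarrow> complex) \<Rightarrow> real \<Rightarrow> complex" where
  "gamma2 b f g x = (1/2) * integral {0..x} (\<lambda>s. deriv_on b g s / f s)"

text \<open>
  The extension of the composition of \<open>gamma2\<close> and \<open>gamma1\<close> to \<open>C\<^sup>1[0,b]\<close>; the lemma
  \<open>gamma21_eq_composition\<close> below shows that it is the composition on \<open>C\<^sup>2[0,b]\<close>.
\<close>

definition gamma21 :: "real \<Rightarrow> (real \<Rightarrow> complex) \<Rightarrow> (real \<Rightarrow> complex) \<Rightarrow> real \<Rightarrow> complex" where
  "gamma21 b q g x =
     (1/2) * (deriv_on b g x - deriv_on b g 0 - integral {0..x} (\<lambda>s. q s * g s))"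

text \<open>
  The Sobolev spaces \<open>W\<^sub>2\<^sup>k[0,b]\<close>. For \<open>k \<ge> 1\<close> the elements are the absolutely continuous
  representatives, that is, indefinite integrals of elements of \<open>W\<^sub>2\<^sup>k\<^sup>-\<^sup>1[0,b]\<close>.
\<close>

primrec sobolev2 :: "real \<Rightarrow> nat \<Rightarrow> (real \<Rightarrow> complex) set" where
  "sobolev2 b 0 =
     {g. g \<in> borel_measurable (lebesgue_on {0..b}) \<and>
         integrable (lebesgue_on {0..b}) (\<lambda>x. (cmod (g x))\<^sup>2)}"
| "sobolev2 b (Suc k) =
     {g. \<exists>h\<in>sobolev2 b k. \<forall>x\<in>{0..b}. g x = g 0 + integral {0..x} h}"

primrec X_fun :: "(real \<Rightarrow> complex) \<Rightarrow> nat \<Rightarrow> real \<Rightarrow> complex" where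
  "X_fun f 0 = (\<lambda>x. 1)"
| "X_fun f (Suc n) =
     (\<lambda>x. of_nat (Suc n) * integral {0..x} (\<lambda>s. X_fun f n s * ((f s)\<^sup>2) powi ((-1) ^ Suc n)))"

primrec Xt_fun :: "(real \<Rightarrow> complex) \<Rightarrow> nat \<Rightarrow> real \<Rightarrow> complex" where
  "Xt_fun f 0 = (\<lambda>x. 1)"
| "Xt_fun f (Suc n) =
     (\<lambda>x. of_nat (Suc n) * integral {0..x} (\<lambda>s. Xt_fun f n s * ((f s)\<^sup>2) powi ((-1) ^ n)))"

definition phi :: "(real \<Rightarrow> complex) \<Rightarrow> nat \<Rightarrow> real \<Rightarrow> complex" where
  "phi f k x = (if odd k then f x * X_fun f k x else f x * Xt_fun f k x)"

definition s_fun :: "(real \<Rightarrow> complex) \<Rightarrow> nat \<Rightarrow> real \<Rightarrow> complex" where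
  "s_fun f m x =
     (\<Sum>k | k \<in> {1..m} \<and> odd k. of_nat (m choose k) * of_real x ^ k * phi f (m - k) x)"

definition s_poly :: "(real \<Rightarrow> complex) \<Rightarrow> nat \<Rightarrow> (nat \<Rightarrow> complex) \<Rightarrow> real \<Rightarrow> complex" where
  "s_poly f N \<beta> x = (\<Sum>n=1..N. \<beta> n * (s_fun f n x / fact n))"

lemma gamma21_eq_composition:
  assumes b: "b > 0"
    and sol: "schroedinger_solution b q f"
    and nz: "\<And>x. x \<in> {0..b} \<Longrightarrow> f x \<noteq> 0"
    and q: "continuous_on {0..b} q"
    and g1: "\<And>x. x \<in> {0..b} \<Longrightarrow> (g has_vector_derivative g' x) (at x within {0..b})"
    and g2: "\<And>x. x \<in> {0..b} \<Longrightarrow> (g' has_vector_derivative g'' x) (at x within {0..b})"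
    and x: "x \<in> {0..b}"
  shows "gamma2 b f (gamma1 b f g) x = gamma21 b q g x"
proof -
  obtain f' where
    f1: "\<And>x. x \<in> {0..b} \<Longrightarrow> (f has_vector_derivative f' x) (at x within {0..b})" and
    f2: "\<And>x. x \<in> {0..b} \<Longrightarrow> (f' has_vector_derivative q x * f x) (at x within {0..b})"
    using sol unfolding schroedinger_solution_def by blast
  have d: "deriv_on b h t = D"
    if "(h has_vector_derivative D) (at t within {0..b})" "t \<in> {0..b}" for h D t
    unfolding deriv_on_def using b that(2,1) by (rule vector_derivative_within_closed_interval)
  have gam1: "gamma1 b f g t = f t * g' t - f' t * g t" if t: "t \<in> {0..b}" for t
  proof -
    let ?D = "(g' t * f t - g t * f' t) / (f t * f t)"
    have "((\<lambda>t. g t / f t) has_derivative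
        (\<lambda>h. (h *\<^sub>R g' t * f t - g t * (h *\<^sub>R f' t)) / (f t * f t))) (at t within {0..b})"
      using g1[OF t] f1[OF t] nz[OF t] unfolding has_vector_derivative_def
      by (rule has_derivative_divide')
    also have "(\<lambda>h. (h *\<^sub>R g' t * f t - g t * (h *\<^sub>R f' t)) / (f t * f t)) = (\<lambda>h. h *\<^sub>R ?D)"
      by (simp add: fun_eq_iff scaleR_conv_of_real algebra_simps diff_divide_distrib)
    finally have "((\<lambda>t. g t / f t) has_vector_derivative ?D) (at t within {0..b})"
      by (simp only: has_vector_derivative_def)
    from d[OF this t] show ?thesis
      using nz[OF t] by (simp add: gamma1_def power2_eq_square mult.commute)
  qed
  have dgam1: "deriv_on b (gamma1 b f g) t / f t = g'' t - q t * g t" if t: "t \<in> {0..b}" for t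
  proof -
    have "((\<lambda>t. f t * g' t - f' t * g t) has_vector_derivative
        (f t * g'' t + f' t * g' t) - (f' t * g' t + q t * f t * g t)) (at t within {0..b})"
      by (intro has_vector_derivative_diff has_vector_derivative_mult f1 f2 g1 g2 t)
    then have "(gamma1 b f g has_vector_derivative
        (f t * g'' t + f' t * g' t) - (f' t * g' t + q t * f t * g t)) (at t within {0..b})"
      by (rule has_vector_derivative_transform[OF t gam1, rotated])
    from d[OF this t] show ?thesis using nz[OF t] by (simp add: field_simps)
  qed
  have sub: "{0..x} \<subseteq> {0..b}" using x by auto
  have "(g'' has_integral (g' x - g' 0)) {0..x}"
    by (rule fundamental_theorem_of_calculus)
      (use x sub in \<open>auto intro: has_vector_derivative_within_subset[OF g2 sub]\<close>)
  moreover have "continuous_on {0..b} g"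
    by (rule continuous_on_vector_derivative[OF g1])
  then have "(\<lambda>s. q s * g s) integrable_on {0..x}"
    by (intro integrable_continuous_interval continuous_intros continuous_on_subset[OF _ sub] q)
  ultimately have "((\<lambda>s. g'' s - q s * g s) has_integral
      (g' x - g' 0 - integral {0..x} (\<lambda>s. q s * g s))) {0..x}"
    by (intro has_integral_diff) (simp_all add: integrable_integral)
  then have "integral {0..x} (\<lambda>s. g'' s - q s * g s) =
      g' x - g' 0 - integral {0..x} (\<lambda>s. q s * g s)"
    by (rule integral_unique)
  moreover have "integral {0..x} (\<lambda>s. deriv_on b (gamma1 b f g) s / f s) =
      integral {0..x} (\<lambda>s. g'' s - q s * g s)"
    using sub dgam1 by (intro integral_cong) auto
  ultimately show ?thesis
    using d[OF g1[OF x] x] d[OF g1[of 0]] b by (simp add: gamma2_def gamma21_def)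
qed

end

theory Submission
  imports Defs
begin

text \<open>
  Write \<open>p\<^sub>k = \<phi>\<^sub>k / k!\<close>. These functions satisfy \<open>p\<^sub>k'' - q p\<^sub>k = p\<^sub>k\<^sub>-\<^sub>2\<close>, so the formal series
  \<open>u = \<Sum> \<lambda>\<^sup>k p\<^sub>k\<close> solves \<open>u'' - q u = \<lambda>\<^sup>2 u\<close>, with \<open>u(0) = 1\<close> and \<open>u'(0) = f'(0) + \<lambda>\<close>. The functions
  \<open>s\<^sub>m / m!\<close> are the coefficients of \<open>sinh(\<lambda>x) u(x)\<close>, and everything becomes simple after splitting
  the hyperbolic sine into its two exponentials: for \<open>\<epsilon> = \<plusminus>1\<close> the function
  \<open>v(x) = exp(\<epsilon>\<lambda>x) u(x)\<close> satisfies \<open>v'' - q v = 2 \<epsilon> \<lambda> v'\<close>. Integrating once,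
  \<open>gamma21 v = \<epsilon> \<lambda> (v - 1)\<close>, which for the coefficients \<open>V \<epsilon> m\<close> of \<open>v\<close> reads
  \<open>gamma21 (V \<epsilon> m) = \<epsilon> V \<epsilon> (m - 1)\<close> for \<open>m \<ge> 2\<close>, while \<open>V \<epsilon> 1\<close> is sent to \<open>\<epsilon> (f - 1)\<close> and \<open>V \<epsilon> 0 = f\<close>
  to \<open>0\<close> (\<open>gamma21_V\<close>). Hence the iterates of \<open>gamma21\<close> on \<open>V \<epsilon> n\<close> descend to \<open>f - 1\<close> after
  \<open>n\<close> steps, and from then on only the iterates on the constant \<open>1\<close> remain, with factor \<open>-\<epsilon>\<^sup>n\<close>
  (\<open>V_orbit\<close>).

  At the origin \<open>gamma1 v = (1 + \<epsilon>) \<lambda>\<close>, so \<open>gamma1\<close> sees only \<open>V \<epsilon> 1\<close> (\<open>gamma1_V_at_0\<close>). Recombining the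
  two signs with weights \<open>\<epsilon> / 2\<close> turns \<open>1 + \<epsilon>\<close> into \<open>1\<close> and \<open>-\<epsilon>\<^sup>n\<close> into \<open>-1\<close> for odd \<open>n\<close> and
  \<open>0\<close> for even \<open>n\<close>. Applied to an s-polynomial, this is the stated relation for its own coefficients
  (\<open>gamma1_funpow_gamma21_s_poly\<close>). The relations determine the \<open>c\<^sub>n\<close> recursively, so no other coefficients
  satisfy them.

  The analytic point is that \<open>gamma21\<close> loses one derivative at each step and is linear only
  where derivatives exist. The orbit of an s-polynomial contains the iterates of \<open>gamma21\<close> on \<open>1\<close>, and
  those that must be differentiated on the whole interval have index at most \<open>N - 3\<close>. The \<open>i\<close>-th iterate involves at
  most \<open>i - 2\<close> derivatives of \<open>q\<close>, so it is continuously differentiable because \<open>q\<close> lies in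
  \<open>W\<^sub>2\<^sup>N\<^sup>-\<^sup>3 \<subseteq> C\<^sup>N\<^sup>-\<^sup>4\<close> (\<open>cont_diff_on_funpow_gamma21_1\<close>). The last iterate, of index \<open>N - 2\<close>, enters only through
  the value of \<open>gamma1\<close> at \<open>0\<close>.
\<close>

section \<open>Derivatives and linearity of the operators\<close>

lemma deriv_on_eq:
  assumes "b > 0" "(h has_vector_derivative D) (at t within {0..b})" "t \<in> {0..b}"
  shows "deriv_on b h t = D"
  unfolding deriv_on_def using assms(1,3,2) by (rule vector_derivative_within_closed_interval)

text \<open>
  The function is allowed to differ from \<open>g\<close> outside \<open>[0,b]\<close>: iterates of \<open>gamma21\<close> are known
  explicitly only on the interval.
\<close>

lemma gamma21_eq:
  assumes "b > 0" "x \<in> {0..b}"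
    and "\<And>t. t \<in> {0..b} \<Longrightarrow> (g has_vector_derivative g' t) (at t within {0..b})"
    and "\<And>t. t \<in> {0..b} \<Longrightarrow> h t = g t"
  shows "gamma21 b q h x = (1/2) * (g' x - g' 0 - integral {0..x} (\<lambda>s. q s * g s))"
proof -
  have h: "(h has_vector_derivative g' t) (at t within {0..b})" if "t \<in> {0..b}" for t
    by (rule has_vector_derivative_transform[OF that _ assms(3)[OF that]]) (rule assms(4))
  have "integral {0..x} (\<lambda>s. q s * h s) = integral {0..x} (\<lambda>s. q s * g s)"
    using assms(2,4) by (intro integral_cong) auto
  with deriv_on_eq[OF assms(1) h] assms(1,2) show ?thesis
    by (simp add: gamma21_def)
qed

lemma gamma21_sum:
  assumes b: "b > 0" and q: "continuous_on {0..b} q" and x: "x \<in> {0..b}" and A: "finite A"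
    and diff: "\<And>a t. a \<in> A \<Longrightarrow> t \<in> {0..b} \<Longrightarrow> g a differentiable (at t within {0..b})"
  shows "gamma21 b q (\<lambda>t. \<Sum>a\<in>A. c a * g a t) x = (\<Sum>a\<in>A. c a * gamma21 b q (g a) x)"
proof -
  define g' where "g' a t = vector_derivative (g a) (at t within {0..b})" for a t
  have g': "(g a has_vector_derivative g' a t) (at t within {0..b})" if "a \<in> A" "t \<in> {0..b}" for a t
    using diff[OF that] by (simp add: g'_def vector_derivative_works)
  have sum': "((\<lambda>t. \<Sum>a\<in>A. c a * g a t) has_vector_derivative (\<Sum>a\<in>A. c a * g' a t))
      (at t within {0..b})" if "t \<in> {0..b}" for t
    using that by (intro has_vector_derivative_sum has_vector_derivative_mult_right g')
  have "continuous_on {0..b} (g a)" if "a \<in> A" for a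
    by (rule continuous_on_vector_derivative[OF g'[OF that]])
  then have int: "(\<lambda>s. q s * g a s) integrable_on {0..x}" if "a \<in> A" for a
    using that x
    by (intro integrable_continuous_interval continuous_on_subset[of "{0..b}" _ "{0..x}"]
        continuous_intros q) auto
  have "integral {0..x} (\<lambda>s. q s * (\<Sum>a\<in>A. c a * g a s)) =
      integral {0..x} (\<lambda>s. \<Sum>a\<in>A. c a * (q s * g a s))"
    by (simp add: sum_distrib_left mult_ac)
  also have "\<dots> = (\<Sum>a\<in>A. integral {0..x} (\<lambda>s. c a * (q s * g a s)))"
    using A int by (intro integral_sum integrable_on_mult_right)
  finally have I: "integral {0..x} (\<lambda>s. q s * (\<Sum>a\<in>A. c a * g a s)) =
      (\<Sum>a\<in>A. c a * integral {0..x} (\<lambda>s. q s * g a s))" by simp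
  have gam: "gamma21 b q (g a) x = (1/2) * (g' a x - g' a 0 - integral {0..x} (\<lambda>s. q s * g a s))"
    if "a \<in> A" for a
    using b x g'[OF that] by (rule gamma21_eq) auto
  have "(\<Sum>a\<in>A. c a * gamma21 b q (g a) x) = (1/2) * (\<Sum>a\<in>A. c a * g' a x
      - c a * g' a 0 - c a * integral {0..x} (\<lambda>s. q s * g a s))"
    by (simp add: gam sum_distrib_left algebra_simps)
  moreover have "gamma21 b q (\<lambda>t. \<Sum>a\<in>A. c a * g a t) x =
      (1/2) * ((\<Sum>a\<in>A. c a * g' a x) - (\<Sum>a\<in>A. c a * g' a 0)
        - integral {0..x} (\<lambda>s. q s * (\<Sum>a\<in>A. c a * g a s)))"
    using b x sum' by (rule gamma21_eq) auto
  ultimately show ?thesis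
    by (simp add: I sum_subtractf) algebra
qed

lemma gamma1_eq:
  assumes "b > 0" "x \<in> {0..b}" "\<And>t. t \<in> {0..b} \<Longrightarrow> h t = g t"
    and "((\<lambda>t. g t / f t) has_vector_derivative D) (at x within {0..b})"
  shows "gamma1 b f h x = (f x)\<^sup>2 * D"
proof -
  have "((\<lambda>t. h t / f t) has_vector_derivative D) (at x within {0..b})"
    by (rule has_vector_derivative_transform[OF assms(2) _ assms(4)]) (simp add: assms(3))
  from deriv_on_eq[OF assms(1) this assms(2)] show ?thesis by (simp add: gamma1_def)
qed

lemma gamma1_sum:
  assumes b: "b > 0" and x: "x \<in> {0..b}"
    and h: "\<And>t. t \<in> {0..b} \<Longrightarrow> h t = (\<Sum>a\<in>A. c a * g a t)"
    and diff: "\<And>a. a \<in> A \<Longrightarrow> (\<lambda>t. g a t / f t) differentiable (at x within {0..b})"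
  shows "gamma1 b f h x = (\<Sum>a\<in>A. c a * gamma1 b f (g a) x)"
proof -
  define D where "D a = vector_derivative (\<lambda>t. g a t / f t) (at x within {0..b})" for a
  have D: "((\<lambda>t. g a t / f t) has_vector_derivative D a) (at x within {0..b})" if "a \<in> A" for a
    using diff[OF that] by (simp add: D_def vector_derivative_works)
  have "((\<lambda>t. \<Sum>a\<in>A. c a * (g a t / f t)) has_vector_derivative (\<Sum>a\<in>A. c a * D a))
      (at x within {0..b})"
    by (intro has_vector_derivative_sum has_vector_derivative_mult_right D)
  then have "((\<lambda>t. (\<Sum>a\<in>A. c a * g a t) / f t) has_vector_derivative (\<Sum>a\<in>A. c a * D a))
      (at x within {0..b})"
    by (simp add: sum_divide_distrib)
  from gamma1_eq[OF b x h this] have "gamma1 b f h x = (\<Sum>a\<in>A. c a * ((f x)\<^sup>2 * D a))"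
    by (simp add: sum_distrib_left mult_ac)
  moreover have "gamma1 b f (g a) x = (f x)\<^sup>2 * D a" if "a \<in> A" for a
    using b x _ D[OF that] by (rule gamma1_eq) simp
  ultimately show ?thesis by simp
qed

text \<open>
  Since \<open>gamma21\<close> is linear only on differentiable functions, an iterate of it applied to a linear
  combination can be split only while all intermediate functions stay differentiable. The
  predicate collects the sequences \<open>t 0, t 1, \<dots>\<close> for which this is the case up to length \<open>N\<close>.
\<close>

definition gamma21_orbit :: "real \<Rightarrow> (real \<Rightarrow> complex) \<Rightarrow> nat \<Rightarrow> (nat \<Rightarrow> real \<Rightarrow> complex) \<Rightarrow> bool" where
  "gamma21_orbit b q N t \<longleftrightarrow> (\<forall>j x. Suc j < N \<longrightarrow> x \<in> {0..b} \<longrightarrow>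
     t j differentiable (at x within {0..b}) \<and> gamma21 b q (t j) x = t (Suc j) x)"

lemma gamma21_orbit_sum:
  assumes "b > 0" "continuous_on {0..b} q" "finite A" "\<And>a. a \<in> A \<Longrightarrow> gamma21_orbit b q N (t a)"
  shows "gamma21_orbit b q N (\<lambda>j x. \<Sum>a\<in>A. c a * t a j x)"
  unfolding gamma21_orbit_def
proof (intro allI impI conjI)
  fix j x assume j: "Suc j < N" and x: "x \<in> {0..b}"
  have d: "t a j differentiable (at y within {0..b})" if "a \<in> A" "y \<in> {0..b}" for a y
    using assms(4) j that unfolding gamma21_orbit_def by blast
  show "(\<lambda>x. \<Sum>a\<in>A. c a * t a j x) differentiable (at x within {0..b})"
    using d x assms(3) by (intro differentiable_sum differentiable_mult differentiable_const) auto
  show "gamma21 b q (\<lambda>x. \<Sum>a\<in>A. c a * t a j x) x = (\<Sum>a\<in>A. c a * t a (Suc j) x)"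
    using gamma21_sum[OF assms(1,2) x assms(3) d] assms(4) j x
    by (simp add: gamma21_orbit_def)
qed

text \<open>
  This is how explicit formulas for iterates are obtained: guess the orbit, check a single step for
  each member, and combine orbits linearly by \<open>gamma21_orbit_sum\<close>.
\<close>

lemma funpow_gamma21_orbit:
  assumes b: "b > 0" and orb: "gamma21_orbit b q N t" and j: "j < N"
    and "\<And>x. x \<in> {0..b} \<Longrightarrow> g x = t 0 x" and "x \<in> {0..b}"
  shows "(gamma21 b q ^^ j) g x = t j x"
  using j assms(5)
proof (induction j arbitrary: x)
  case 0
  then show ?case using assms(4) by simp
next
  case (Suc j)
  define t' where "t' y = vector_derivative (t j) (at y within {0..b})" for y
  have t': "(t j has_vector_derivative t' y) (at y within {0..b})" if "y \<in> {0..b}" for y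
    using orb Suc.prems that by (simp add: gamma21_orbit_def t'_def vector_derivative_works)
  have "(gamma21 b q ^^ Suc j) g x = gamma21 b q ((gamma21 b q ^^ j) g) x" by simp
  also have "\<dots> = gamma21 b q (t j) x"
  proof -
    have "(gamma21 b q ^^ j) g y = t j y" if "y \<in> {0..b}" for y
      using Suc.IH Suc.prems(1) that by simp
    then show ?thesis
      using gamma21_eq[OF b Suc.prems(2) t', of "(gamma21 b q ^^ j) g" q]
        gamma21_eq[OF b Suc.prems(2) t', of "t j" q] by metis
  qed
  also have "\<dots> = t (Suc j) x"
    using orb Suc.prems by (simp add: gamma21_orbit_def)
  finally show ?case .
qed

section \<open>Regularity of the iterates on the constant function\<close>

text \<open>
  The space \<open>C\<^sup>k[0,b]\<close> with one-sided derivatives at the end points.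
\<close>

primrec cont_diff_on :: "real \<Rightarrow> nat \<Rightarrow> (real \<Rightarrow> complex) \<Rightarrow> bool" where
  "cont_diff_on b 0 g \<longleftrightarrow> continuous_on {0..b} g"
| "cont_diff_on b (Suc k) g \<longleftrightarrow>
     (\<exists>g'. (\<forall>x\<in>{0..b}. (g has_vector_derivative g' x) (at x within {0..b})) \<and> cont_diff_on b k g')"

lemma cont_diff_on_cong:
  assumes "cont_diff_on b k g" "\<And>x. x \<in> {0..b} \<Longrightarrow> h x = g x"
  shows "cont_diff_on b k h"
proof (cases k)
  case 0
  then show ?thesis using assms continuous_on_cong[of "{0..b}" "{0..b}" h g] by simp
next
  case (Suc k')
  with assms(1) obtain g' where
    g': "\<forall>x\<in>{0..b}. (g has_vector_derivative g' x) (at x within {0..b})" "cont_diff_on b k' g'"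
    by auto
  then have "(h has_vector_derivative g' x) (at x within {0..b})" if "x \<in> {0..b}" for x
    using that assms(2) by (blast intro: has_vector_derivative_transform)
  with g'(2) show ?thesis unfolding Suc cont_diff_on.simps by blast
qed

lemma cont_diff_on_Suc_imp: "cont_diff_on b (Suc k) g \<Longrightarrow> cont_diff_on b k g"
proof (induction k arbitrary: g)
  case 0
  then show ?case by (auto intro: continuous_on_vector_derivative)
next
  case (Suc k)
  then show ?case by (metis cont_diff_on.simps(2))
qed

lemma cont_diff_on_le: "cont_diff_on b k g \<Longrightarrow> l \<le> k \<Longrightarrow> cont_diff_on b l g"
  by (induction k) (auto simp del: cont_diff_on.simps simp: le_Suc_eq dest: cont_diff_on_Suc_imp)

lemma cont_diff_on_const: "cont_diff_on b k (\<lambda>x. c)"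
proof (induction k arbitrary: c)
  case (Suc k)
  then show ?case by (auto intro!: exI[of _ "\<lambda>x. 0"] derivative_eq_intros)
qed simp

lemma cont_diff_on_add:
  "cont_diff_on b k g \<Longrightarrow> cont_diff_on b k h \<Longrightarrow> cont_diff_on b k (\<lambda>x. g x + h x)"
proof (induction k arbitrary: g h)
  case (Suc k)
  from Suc.prems obtain g' h' where
    "\<forall>x\<in>{0..b}. (g has_vector_derivative g' x) (at x within {0..b})" "cont_diff_on b k g'"
    "\<forall>x\<in>{0..b}. (h has_vector_derivative h' x) (at x within {0..b})" "cont_diff_on b k h'"
    by auto
  with Suc.IH show ?case
    by (auto intro!: exI[of _ "\<lambda>x. g' x + h' x"] has_vector_derivative_add)
qed (auto intro: continuous_on_add)

lemma cont_diff_on_mult: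
  "cont_diff_on b k g \<Longrightarrow> cont_diff_on b k h \<Longrightarrow> cont_diff_on b k (\<lambda>x. g x * h x)"
proof (induction k arbitrary: g h)
  case (Suc k)
  from Suc.prems obtain g' h' where
    "\<forall>x\<in>{0..b}. (g has_vector_derivative g' x) (at x within {0..b})" "cont_diff_on b k g'"
    "\<forall>x\<in>{0..b}. (h has_vector_derivative h' x) (at x within {0..b})" "cont_diff_on b k h'"
    by auto
  moreover have "cont_diff_on b k g" "cont_diff_on b k h"
    using Suc.prems by (blast dest: cont_diff_on_Suc_imp)+
  ultimately show ?case using Suc.IH
    by (auto intro!: exI[of _ "\<lambda>x. g x * h' x + g' x * h x"] has_vector_derivative_mult
        cont_diff_on_add)
qed (auto intro: continuous_on_mult)

lemma cont_diff_on_integral: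
  assumes "cont_diff_on b k g"
  shows "cont_diff_on b (Suc k) (\<lambda>x. integral {0..x} g)"
proof -
  have "continuous_on {0..b} g" using cont_diff_on_le[OF assms, of 0] by simp
  with assms show ?thesis by (auto intro!: exI[of _ g] integral_has_vector_derivative)
qed

text \<open>
  On a bounded interval square integrability implies integrability, since \<open>t \<le> 1 + t\<^sup>2\<close>.
\<close>

lemma sobolev2_0_integrable:
  assumes "h \<in> sobolev2 b 0"
  shows "h integrable_on {0..b}"
proof -
  have m: "h \<in> borel_measurable (lebesgue_on {0..b})"
    and i: "integrable (lebesgue_on {0..b}) (\<lambda>x. (cmod (h x))\<^sup>2)"
    using assms by auto
  have "integrable (lebesgue_on {0..b}) (\<lambda>x. 1 + (cmod (h x))\<^sup>2)"
    using i by (intro Bochner_Integration.integrable_add) auto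
  then have "integrable (lebesgue_on {0..b}) h"
  proof (rule Bochner_Integration.integrable_bound[OF _ m], intro AE_I2)
    fix x
    have "cmod (h x) \<le> 1 + (cmod (h x))\<^sup>2"
      using zero_le_power2[of "cmod (h x) - 1"] norm_ge_zero[of "h x"]
      unfolding power2_diff by (simp only: power_one; linarith)
    then show "norm (h x) \<le> norm (1 + (cmod (h x))\<^sup>2)" by simp
  qed
  then show ?thesis by (rule integrable_on_lebesgue_on) simp
qed

text \<open>
  The embedding of \<open>W\<^sub>2\<^sup>k\<^sup>+\<^sup>1\<close> into \<open>C\<^sup>k\<close>: an indefinite integral of an integrable function is
  continuous, and each further integration gains one derivative.
\<close>

lemma sobolev2_Suc_cont_diff_on: "g \<in> sobolev2 b (Suc k) \<Longrightarrow> cont_diff_on b k g"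
proof (induction k arbitrary: g)
  case 0
  then obtain h where h: "h \<in> sobolev2 b 0" "\<forall>x\<in>{0..b}. g x = g 0 + integral {0..x} h"
    unfolding sobolev2.simps(2) by blast
  have "cont_diff_on b 0 (\<lambda>x. g 0 + integral {0..x} h)"
    unfolding cont_diff_on.simps
    by (intro continuous_intros indefinite_integral_continuous_1 sobolev2_0_integrable h)
  then show ?case by (rule cont_diff_on_cong) (use h(2) in blast)
next
  case (Suc k)
  then obtain h where h: "h \<in> sobolev2 b (Suc k)" "\<forall>x\<in>{0..b}. g x = g 0 + integral {0..x} h"
    unfolding sobolev2.simps(2)[of b "Suc k"] by blast
  have "cont_diff_on b (Suc k) (\<lambda>x. g 0 + integral {0..x} h)"
    by (intro cont_diff_on_add cont_diff_on_const cont_diff_on_integral Suc.IH h)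
  then show ?case by (rule cont_diff_on_cong) (use h(2) in blast)
qed

text \<open>
  Of the two terms of \<open>gamma21\<close>, the derivative costs one order of smoothness of \<open>g\<close>, whereas the
  integral is one order smoother than \<open>q g\<close>; this is why \<open>r\<close> may exceed \<open>m\<close> by one.
\<close>

lemma cont_diff_on_gamma21:
  assumes "b > 0" and q: "cont_diff_on b m q" and g: "cont_diff_on b (Suc r) g" and r: "r \<le> Suc m"
  shows "cont_diff_on b r (gamma21 b q g)"
proof -
  from g obtain g' where g': "\<And>x. x \<in> {0..b} \<Longrightarrow> (g has_vector_derivative g' x) (at x within {0..b})"
    and c: "cont_diff_on b r g'" unfolding cont_diff_on.simps by blast
  have "cont_diff_on b (r - 1) (\<lambda>s. q s * g s)"
    using r by (intro cont_diff_on_mult cont_diff_on_le[OF q] cont_diff_on_le[OF g]) auto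
  then have I: "cont_diff_on b r (\<lambda>x. integral {0..x} (\<lambda>s. q s * g s))"
    by (intro cont_diff_on_le[OF cont_diff_on_integral]) auto
  have "cont_diff_on b r
      (\<lambda>x. (1/2) * (g' x + (- g' 0 + (-1) * integral {0..x} (\<lambda>s. q s * g s))))"
    by (intro cont_diff_on_mult cont_diff_on_add cont_diff_on_const c I)
  then show ?thesis
    by (rule cont_diff_on_cong) (subst gamma21_eq[OF assms(1) _ g'], auto)
qed

lemma cont_diff_on_funpow_gamma21_1:
  assumes "b > 0" "cont_diff_on b m q" "i + r \<le> m + 2"
  shows "cont_diff_on b r ((gamma21 b q ^^ i) (\<lambda>x. 1))"
  using assms(3)
proof (induction i arbitrary: r)
  case 0
  then show ?case by (simp add: cont_diff_on_const)
next
  case (Suc i)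
  then have "cont_diff_on b (Suc r) ((gamma21 b q ^^ i) (\<lambda>x. 1))"
    by (simp del: cont_diff_on.simps)
  from cont_diff_on_gamma21[OF assms(1,2) this] Suc.prems show ?case by simp
qed

section \<open>Convolutions with the exponential series\<close>

text \<open>
  With \<open>shift\<close> in place of \<open>a (k - 1)\<close> the terms of negative index are \<open>0\<close>, so that the
  differential equations below hold for all indices without special cases. On generating functions
  it is multiplication by the parameter \<open>\<lambda>\<close>.
\<close>

definition shift :: "(nat \<Rightarrow> real \<Rightarrow> complex) \<Rightarrow> nat \<Rightarrow> real \<Rightarrow> complex" where
  "shift a k x = (case k of 0 \<Rightarrow> 0 | Suc l \<Rightarrow> a l x)"

lemma shift_simps [simp]: "shift a 0 x = 0" "shift a (Suc k) x = a k x"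
  by (simp_all add: shift_def)

lemma has_vector_derivative_shift:
  assumes "\<And>k. (a k has_vector_derivative a' k x) F"
  shows "(shift a k has_vector_derivative shift a' k x) F"
  using assms by (cases k) (auto simp: shift_def[abs_def])

text \<open>
  The coefficient of \<open>\<lambda>\<^sup>m\<close> in \<open>exp(\<epsilon>\<lambda>x) \<Sum> \<lambda>\<^sup>k a\<^sub>k(x)\<close>.
\<close>

definition exp_conv :: "complex \<Rightarrow> (nat \<Rightarrow> real \<Rightarrow> complex) \<Rightarrow> nat \<Rightarrow> real \<Rightarrow> complex" where
  "exp_conv \<epsilon> a m x = (\<Sum>k\<le>m. (\<epsilon> ^ k * of_real x ^ k / fact k) * a (m - k) x)"

lemma exp_conv_0: "exp_conv \<epsilon> a m 0 = a m 0"
proof -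
  have "exp_conv \<epsilon> a m 0 = (\<Sum>k\<le>m. if k = 0 then a m 0 else 0)"
    unfolding exp_conv_def by (intro sum.cong) (auto simp: power_0_left)
  then show ?thesis by simp
qed

lemma exp_conv_shift [simp]:
  "exp_conv \<epsilon> (shift a) 0 x = 0" "exp_conv \<epsilon> (shift a) (Suc m) x = exp_conv \<epsilon> a m x"
proof -
  show "exp_conv \<epsilon> (shift a) (Suc m) x = exp_conv \<epsilon> a m x"
    unfolding exp_conv_def by (simp add: Suc_diff_le)
qed (simp add: exp_conv_def)

lemma exp_conv_add: "exp_conv \<epsilon> (\<lambda>k x. c x * a k x + d k x) m x = c x * exp_conv \<epsilon> a m x + exp_conv \<epsilon> d m x"
  by (simp add: exp_conv_def sum.distrib sum_distrib_left algebra_simps)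

text \<open>
  The product rule for \<open>exp(\<epsilon>\<lambda>x) \<Sum> \<lambda>\<^sup>k a\<^sub>k(x)\<close>, coefficient by coefficient: differentiating the
  exponential brings down \<open>\<epsilon>\<lambda>\<close>.
\<close>

lemma has_vector_derivative_exp_conv:
  assumes "\<And>k. (a k has_vector_derivative a' k x) (at x within S)"
  shows "(exp_conv \<epsilon> a m has_vector_derivative
            exp_conv \<epsilon> a' m x + \<epsilon> * exp_conv \<epsilon> (shift a) m x) (at x within S)"
proof -
  define e where "e k y = \<epsilon> ^ k * of_real y ^ k / fact k" for k and y :: real
  have e: "(e k has_vector_derivative \<epsilon> * shift e k x) (at x within S)" for k
  proof (cases k)
    case (Suc l)
    have "((\<lambda>y. of_real y ^ Suc l) has_vector_derivative of_nat (Suc l) * complex_of_real x ^ l)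
        (at x within S)"
      by (rule has_vector_derivative_eq_rhs[OF has_vector_derivative_real_field])
         (auto intro!: derivative_eq_intros, cases l, auto simp: algebra_simps)
    then have "((\<lambda>y. \<epsilon> ^ Suc l / fact (Suc l) * of_real y ^ Suc l) has_vector_derivative
        \<epsilon> ^ Suc l / fact (Suc l) * (of_nat (Suc l) * complex_of_real x ^ l)) (at x within S)"
      by (rule has_vector_derivative_mult_right)
    moreover have "\<epsilon> ^ Suc l / fact (Suc l) * (of_nat (Suc l) * complex_of_real x ^ l)
        = \<epsilon> * shift e k x"
      by (simp add: Suc e_def field_simps del: of_nat_Suc)
    ultimately show ?thesis by (simp add: e_def[abs_def] Suc del: fact_Suc power_Suc)
  qed (simp add: e_def[abs_def])
  have "((\<lambda>y. \<Sum>k\<le>m. e k y * a (m - k) y) has_vector_derivative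
      (\<Sum>k\<le>m. e k x * a' (m - k) x + \<epsilon> * shift e k x * a (m - k) x)) (at x within S)"
    by (intro has_vector_derivative_sum has_vector_derivative_mult e assms)
  moreover have "(\<Sum>k\<le>m. shift e k x * a (m - k) x) = exp_conv \<epsilon> (shift a) m x"
    by (cases m) (simp_all add: sum.atMost_Suc_shift exp_conv_def[of _ a] e_def del: sum.atMost_Suc)
  ultimately show ?thesis
    by (simp add: exp_conv_def[of _ a, abs_def] exp_conv_def[of _ a'] e_def sum.distrib
        mult.assoc flip: sum_distrib_left)
qed

section \<open>Normalized formal powers\<close>

locale nonvanishing_solution =
  fixes b :: real and q f f' :: "real \<Rightarrow> complex"
  assumes b_pos: "b > 0"
    and q_cont: "continuous_on {0..b} q"
    and f_deriv: "\<And>x. x \<in> {0..b} \<Longrightarrow> (f has_vector_derivative f' x) (at x within {0..b})"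
    and f'_deriv: "\<And>x. x \<in> {0..b} \<Longrightarrow> (f' has_vector_derivative q x * f x) (at x within {0..b})"
    and f_0: "f 0 = 1"
    and f_nonzero: "\<And>x. x \<in> {0..b} \<Longrightarrow> f x \<noteq> 0"
begin

lemma f_cont: "continuous_on {0..b} f"
  by (rule continuous_on_vector_derivative[OF f_deriv])

text \<open>
  The exponent is \<open>1\<close> or \<open>-1\<close>, and \<open>f\<close> has no zeros.
\<close>

lemma f_powi_cont: "continuous_on {0..b} (\<lambda>s. (f s)\<^sup>2 powi ((-1) ^ n))"
  by (cases "even n") (auto intro!: continuous_intros f_cont simp: f_nonzero)

lemma X_fun_cont: "continuous_on {0..b} (X_fun f n)"
proof (induction n)
  case (Suc n)
  then show ?case unfolding X_fun.simps
    by (intro continuous_intros indefinite_integral_continuous_1 integrable_continuous_interval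
        f_powi_cont)
qed simp

lemma Xt_fun_cont: "continuous_on {0..b} (Xt_fun f n)"
proof (induction n)
  case (Suc n)
  then show ?case unfolding Xt_fun.simps
    by (intro continuous_intros indefinite_integral_continuous_1 integrable_continuous_interval
        f_powi_cont)
qed simp

lemma X_fun_deriv:
  assumes "x \<in> {0..b}"
  shows "(X_fun f (Suc n) has_vector_derivative
    of_nat (Suc n) * (X_fun f n x * (f x)\<^sup>2 powi ((-1) ^ Suc n))) (at x within {0..b})"
  unfolding X_fun.simps using assms
  by (intro has_vector_derivative_mult_right integral_has_vector_derivative continuous_intros
      X_fun_cont f_powi_cont)

lemma Xt_fun_deriv:
  assumes "x \<in> {0..b}"
  shows "(Xt_fun f (Suc n) has_vector_derivative
    of_nat (Suc n) * (Xt_fun f n x * (f x)\<^sup>2 powi ((-1) ^ n))) (at x within {0..b})"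
  unfolding Xt_fun.simps using assms
  by (intro has_vector_derivative_mult_right integral_has_vector_derivative continuous_intros
      Xt_fun_cont f_powi_cont)

text \<open>
  The families \<open>X_fun\<close> and \<open>Xt_fun\<close>, divided by \<open>k!\<close>, are sorted by parity into \<open>A\<close>, where the weight of the last integration is
  always \<open>f\<^sup>-\<^sup>2\<close>, and \<open>B\<close>, where it is always \<open>f\<^sup>2\<close>. Then \<open>A' = shift B / f\<^sup>2\<close> and \<open>B' = shift A f\<^sup>2\<close>,
  and \<open>f A\<^sub>k\<close> is \<open>\<phi>\<^sub>k / k!\<close>.
\<close>

definition A :: "nat \<Rightarrow> real \<Rightarrow> complex" where
  "A k x = (if odd k then X_fun f k x else Xt_fun f k x) / fact k"

definition B :: "nat \<Rightarrow> real \<Rightarrow> complex" where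
  "B k x = (if odd k then Xt_fun f k x else X_fun f k x) / fact k"

lemma fact_Suc_cancel: "of_nat (Suc k) * z / fact (Suc k) = (z :: complex) / fact k"
  by (simp add: field_simps del: of_nat_Suc)

lemma A_deriv:
  assumes x: "x \<in> {0..b}"
  shows "(A k has_vector_derivative shift B k x / (f x)\<^sup>2) (at x within {0..b})"
proof (cases k)
  case 0
  then show ?thesis by (simp add: A_def[abs_def])
next
  case (Suc l)
  show ?thesis
  proof (cases "even l")
    case True
    from has_vector_derivative_divide[OF X_fun_deriv[OF x, of l], of "fact (Suc l)"] True
    show ?thesis unfolding fact_Suc_cancel
      by (simp add: Suc A_def[abs_def] B_def divide_inverse mult_ac del: X_fun.simps fact_Suc)
  next
    case False
    from has_vector_derivative_divide[OF Xt_fun_deriv[OF x, of l], of "fact (Suc l)"] False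
    show ?thesis unfolding fact_Suc_cancel
      by (simp add: Suc A_def[abs_def] B_def divide_inverse mult_ac del: Xt_fun.simps fact_Suc)
  qed
qed

lemma B_deriv:
  assumes x: "x \<in> {0..b}"
  shows "(B k has_vector_derivative shift A k x * (f x)\<^sup>2) (at x within {0..b})"
proof (cases k)
  case 0
  then show ?thesis by (simp add: B_def[abs_def])
next
  case (Suc l)
  show ?thesis
  proof (cases "even l")
    case True
    from has_vector_derivative_divide[OF Xt_fun_deriv[OF x, of l], of "fact (Suc l)"] True
    show ?thesis unfolding fact_Suc_cancel
      by (simp add: Suc A_def B_def[abs_def] divide_inverse mult_ac del: Xt_fun.simps fact_Suc)
  next
    case False
    from has_vector_derivative_divide[OF X_fun_deriv[OF x, of l], of "fact (Suc l)"] False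
    show ?thesis unfolding fact_Suc_cancel
      by (simp add: Suc A_def B_def[abs_def] divide_inverse mult_ac del: X_fun.simps fact_Suc)
  qed
qed

text \<open>
  The function \<open>p k\<close> is \<open>\<phi>\<^sub>k / k!\<close> and \<open>p' k\<close> its derivative; the prime is part of the name.
\<close>

definition p :: "nat \<Rightarrow> real \<Rightarrow> complex" where
  "p k x = f x * A k x"

definition p' :: "nat \<Rightarrow> real \<Rightarrow> complex" where
  "p' k x = f' x * A k x + shift B k x / f x"

lemma p_eq_phi: "p k x = phi f k x / fact k"
  by (simp add: p_def A_def phi_def)

lemma p_deriv:
  assumes x: "x \<in> {0..b}"
  shows "(p k has_vector_derivative p' k x) (at x within {0..b})"
proof -
  have "((\<lambda>x. f x * A k x) has_vector_derivative f x * (shift B k x / (f x)\<^sup>2) + f' x * A k x)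
      (at x within {0..b})"
    by (intro has_vector_derivative_mult f_deriv A_deriv x)
  then show ?thesis using f_nonzero[OF x]
    by (simp add: p_def[abs_def] p'_def power2_eq_square add.commute)
qed

text \<open>
  The equation \<open>p\<^sub>k'' = q p\<^sub>k + p\<^sub>k\<^sub>-\<^sub>2\<close>. The two first-order terms, from \<open>A' = shift B / f\<^sup>2\<close> and
  from \<open>(1/f)' = -f'/f\<^sup>2\<close>, cancel.
\<close>

lemma p'_deriv:
  assumes x: "x \<in> {0..b}"
  shows "(p' k has_vector_derivative q x * p k x + shift (shift p) k x) (at x within {0..b})"
proof -
  have inv: "((\<lambda>x. inverse (f x)) has_vector_derivative - (inverse (f x) * f' x * inverse (f x)))
      (at x within {0..b})"
    using Deriv.has_derivative_inverse[OF f_nonzero[OF x] f_deriv[OF x, unfolded has_vector_derivative_def]]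
    by (simp add: has_vector_derivative_def scaleR_conv_of_real mult_ac)
  have B': "(shift B k has_vector_derivative shift (\<lambda>k x. shift A k x * (f x)\<^sup>2) k x) (at x within {0..b})"
    by (rule has_vector_derivative_shift) (rule B_deriv[OF x])
  have "((\<lambda>x. f' x * A k x + shift B k x * inverse (f x)) has_vector_derivative
      (f' x * (shift B k x / (f x)\<^sup>2) + q x * f x * A k x) +
      (shift B k x * (- (inverse (f x) * f' x * inverse (f x))) +
       shift (\<lambda>k x. shift A k x * (f x)\<^sup>2) k x * inverse (f x))) (at x within {0..b})"
    by (intro has_vector_derivative_add has_vector_derivative_mult[OF f'_deriv[OF x] A_deriv[OF x]]
        has_vector_derivative_mult[OF B' inv])
  moreover have "shift (\<lambda>k x. shift A k x * (f x)\<^sup>2) k x * inverse (f x) = shift (shift p) k x"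
    using f_nonzero[OF x]
    by (auto simp: shift_def p_def power2_eq_square split: nat.splits)
  ultimately show ?thesis
    by (simp add: p'_def[abs_def] p_def divide_inverse power2_eq_square algebra_simps)
qed

lemma A_B_at_0: "A k 0 = (if k = 0 then 1 else 0)" "B k 0 = (if k = 0 then 1 else 0)"
  by (cases k; simp add: A_def B_def)+

lemma p_at_0: "p k 0 = (if k = 0 then 1 else 0)"
  by (simp add: p_def A_B_at_0 f_0)

text \<open>
  For differentiable functions \<open>gamma1\<close> is the Wronskian with \<open>f\<close>.
\<close>

lemma gamma1_of_derivative:
  assumes "x \<in> {0..b}" "(g has_vector_derivative g') (at x within {0..b})"
  shows "(\<lambda>t. g t / f t) differentiable (at x within {0..b})"
    and "gamma1 b f g x = f x * g' - f' x * g x"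
proof -
  let ?D = "(g' * f x - g x * f' x) / (f x * f x)"
  have "((\<lambda>t. g t / f t) has_derivative
      (\<lambda>h. (h *\<^sub>R g' * f x - g x * (h *\<^sub>R f' x)) / (f x * f x))) (at x within {0..b})"
    using assms(2) f_deriv[OF assms(1)] f_nonzero[OF assms(1)] unfolding has_vector_derivative_def
    by (rule has_derivative_divide')
  also have "(\<lambda>h. (h *\<^sub>R g' * f x - g x * (h *\<^sub>R f' x)) / (f x * f x)) = (\<lambda>h. h *\<^sub>R ?D)"
    by (simp add: fun_eq_iff scaleR_conv_of_real algebra_simps diff_divide_distrib)
  finally have D: "((\<lambda>t. g t / f t) has_vector_derivative ?D) (at x within {0..b})"
    by (simp only: has_vector_derivative_def)
  then show "(\<lambda>t. g t / f t) differentiable (at x within {0..b})"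
    by (rule differentiableI_vector)
  from gamma1_eq[OF b_pos assms(1) _ D, of g] show "gamma1 b f g x = f x * g' - f' x * g x"
    using f_nonzero[OF assms(1)] by (simp add: power2_eq_square mult.commute)
qed

section \<open>Iterates on the s-functions\<close>

abbreviation V :: "complex \<Rightarrow> nat \<Rightarrow> real \<Rightarrow> complex" where
  "V \<epsilon> \<equiv> exp_conv \<epsilon> p"

lemma V_deriv:
  assumes "x \<in> {0..b}"
  shows "(V \<epsilon> m has_vector_derivative
    exp_conv \<epsilon> p' m x + \<epsilon> * exp_conv \<epsilon> (shift p) m x) (at x within {0..b})"
  by (rule has_vector_derivative_exp_conv) (rule p_deriv[OF assms])

lemma V_0: "V \<epsilon> 0 x = f x"
  by (simp add: exp_conv_def p_def A_def)

text \<open>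
  The equation \<open>v'' - q v = 2 \<epsilon> \<lambda> v'\<close> for \<open>v = exp(\<epsilon>\<lambda>x) u\<close>, integrated over \<open>[0,x]\<close>: writing \<open>D\<close> for
  the derivative of \<open>V \<epsilon> m\<close> and \<open>S\<close> for the shifted convolution (the coefficient of \<open>\<lambda>v\<close>), the function
  \<open>D - 2 \<epsilon> S\<close> is a primitive of \<open>q V\<close>.
\<close>

lemma gamma21_V:
  assumes \<epsilon>: "\<epsilon>\<^sup>2 = 1" and x: "x \<in> {0..b}"
  shows "gamma21 b q (V \<epsilon> m) x = \<epsilon> * (exp_conv \<epsilon> (shift p) m x - (if m = 1 then 1 else 0))"
proof -
  let ?D = "\<lambda>t. exp_conv \<epsilon> p' m t + \<epsilon> * exp_conv \<epsilon> (shift p) m t"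
  let ?S = "exp_conv \<epsilon> (shift p) m"
  have "(?D has_vector_derivative
      (exp_conv \<epsilon> (\<lambda>k x. q x * p k x + shift (shift p) k x) m t + \<epsilon> * exp_conv \<epsilon> (shift p') m t) +
      \<epsilon> * (exp_conv \<epsilon> (shift p') m t + \<epsilon> * exp_conv \<epsilon> (shift (shift p)) m t)) (at t within {0..b})"
    if t: "t \<in> {0..b}" for t
    by (intro has_vector_derivative_add has_vector_derivative_mult_right
        has_vector_derivative_exp_conv has_vector_derivative_shift p_deriv[OF t] p'_deriv[OF t])
  moreover have "(?S has_vector_derivative
      exp_conv \<epsilon> (shift p') m t + \<epsilon> * exp_conv \<epsilon> (shift (shift p)) m t) (at t within {0..b})"
    if t: "t \<in> {0..b}" for t
    by (intro has_vector_derivative_exp_conv has_vector_derivative_shift p_deriv[OF t])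
  ultimately have "((\<lambda>t. ?D t - 2 * \<epsilon> * ?S t) has_vector_derivative
      ((exp_conv \<epsilon> (\<lambda>k x. q x * p k x + shift (shift p) k x) m t + \<epsilon> * exp_conv \<epsilon> (shift p') m t) +
      \<epsilon> * (exp_conv \<epsilon> (shift p') m t + \<epsilon> * exp_conv \<epsilon> (shift (shift p)) m t))
      - 2 * \<epsilon> * (exp_conv \<epsilon> (shift p') m t + \<epsilon> * exp_conv \<epsilon> (shift (shift p)) m t))
      (at t within {0..b})" if "t \<in> {0..b}" for t
    using that by (intro has_vector_derivative_diff has_vector_derivative_mult_right)
  moreover have "(exp_conv \<epsilon> (\<lambda>k x. q x * p k x + shift (shift p) k x) m t + \<epsilon> * exp_conv \<epsilon> (shift p') m t) +
      \<epsilon> * (exp_conv \<epsilon> (shift p') m t + \<epsilon> * exp_conv \<epsilon> (shift (shift p)) m t)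
      - 2 * \<epsilon> * (exp_conv \<epsilon> (shift p') m t + \<epsilon> * exp_conv \<epsilon> (shift (shift p)) m t) = q t * V \<epsilon> m t" for t
  proof -
    have "\<epsilon> * (\<epsilon> * z) = z" for z using \<epsilon> by (simp add: power2_eq_square flip: mult.assoc)
    then have "\<epsilon> * (y + \<epsilon> * z) = \<epsilon> * y + z" for y z by (simp only: distrib_left)
    then show ?thesis by (simp only: exp_conv_add mult.assoc) simp
  qed
  ultimately have d: "((\<lambda>t. ?D t - 2 * \<epsilon> * ?S t) has_vector_derivative q t * V \<epsilon> m t) (at t within {0..b})"
    if "t \<in> {0..b}" for t
    using that by simp
  have "((\<lambda>t. q t * V \<epsilon> m t) has_integral (?D x - 2 * \<epsilon> * ?S x) - (?D 0 - 2 * \<epsilon> * ?S 0)) {0..x}"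
  proof (rule fundamental_theorem_of_calculus)
    fix t assume "t \<in> {0..x}"
    moreover have "{0..x} \<subseteq> {0..b}" using x by simp
    ultimately show "((\<lambda>t. ?D t - 2 * \<epsilon> * ?S t) has_vector_derivative q t * V \<epsilon> m t)
        (at t within {0..x})"
      using has_vector_derivative_within_subset[OF d] by blast
  qed (use x in simp)
  then have I: "integral {0..x} (\<lambda>t. q t * V \<epsilon> m t) = (?D x - 2 * \<epsilon> * ?S x) - (?D 0 - 2 * \<epsilon> * ?S 0)"
    by (rule integral_unique)
  have S0: "?S 0 = (if m = 1 then 1 else 0)"
    by (cases m) (simp_all add: exp_conv_0 p_at_0)
  have "gamma21 b q (V \<epsilon> m) x
      = (1/2) * (?D x - ?D 0 - integral {0..x} (\<lambda>s. q s * V \<epsilon> m s))"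
    using b_pos x V_deriv by (rule gamma21_eq) auto
  then show ?thesis
    unfolding I S0 by (simp only:) (simp add: algebra_simps)
qed

text \<open>
  At \<open>0\<close> the exponential contributes \<open>\<epsilon> p\<^sub>0(0) = \<epsilon>\<close> and \<open>p\<^sub>1\<close> contributes \<open>1\<close>, both for \<open>m = 1\<close>; in
  particular \<open>V \<epsilon> 0 = f\<close> is annihilated.
\<close>

lemma gamma1_V_at_0: "gamma1 b f (V \<epsilon> m) 0 = (if m = 1 then 1 + \<epsilon> else 0)"
proof -
  have 0: "0 \<in> {0..b}" using b_pos by simp
  show ?thesis
    unfolding gamma1_of_derivative(2)[OF 0 V_deriv[OF 0]]
    by (cases m) (auto simp: exp_conv_0 p_at_0 p'_def A_B_at_0 f_0)
qed

text \<open>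
  The coefficients of \<open>sinh(\<lambda>x) u(x)\<close>: averaging with weights \<open>\<epsilon> / 2\<close> keeps the odd powers
  \<open>\<epsilon>\<^sup>k\<close> and cancels the even ones.
\<close>

lemma s_fun_eq_V: "s_fun f m x / fact m = (\<Sum>\<epsilon>\<in>{1, -1}. (\<epsilon> / 2) * V \<epsilon> m x)"
proof -
  have "(\<Sum>\<epsilon>\<in>{1, -1}. (\<epsilon> / 2) * V \<epsilon> m x)
      = (\<Sum>k\<le>m. (1/2) * (1 - (-1) ^ k) * (of_real x ^ k / fact k) * p (m - k) x)"
  proof -
    have "(\<Sum>\<epsilon>\<in>{1, -1}. (\<epsilon> / 2) * V \<epsilon> m x) = (1/2) * (V 1 m x - V (-1) m x)"
      by (simp add: algebra_simps)
    then show ?thesis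
      unfolding exp_conv_def sum_distrib_left sum_subtractf[symmetric]
      by (simp add: algebra_simps)
  qed
  also have "\<dots> = (\<Sum>k\<in>{..m}. if k \<in> {1..m} \<and> odd k then
      of_nat (m choose k) * of_real x ^ k * phi f (m - k) x / fact m else 0)"
  proof (intro sum.cong refl)
    fix k assume "k \<in> {..m}"
    moreover have "k \<in> {1..m} \<longleftrightarrow> k \<le> m" if "odd k"
      using odd_pos[OF that] by auto
    ultimately show "(1/2) * (1 - (-1) ^ k) * (of_real x ^ k / fact k) * p (m - k) x =
        (if k \<in> {1..m} \<and> odd k
         then of_nat (m choose k) * of_real x ^ k * phi f (m - k) x / fact m else 0)"
      by (cases "odd k") (simp_all add: p_eq_phi binomial_fact)
  qed
  also have "\<dots> = (\<Sum>k\<in>{..m} \<inter> {k. k \<in> {1..m} \<and> odd k}.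
      of_nat (m choose k) * of_real x ^ k * phi f (m - k) x / fact m)"
    by (simp add: sum.inter_restrict)
  also have "{..m} \<inter> {k. k \<in> {1..m} \<and> odd k} = {k. k \<in> {1..m} \<and> odd k}" by auto
  finally show ?thesis by (simp add: s_fun_def sum_divide_distrib)
qed

text \<open>
  The \<open>j\<close>-th iterate of \<open>gamma21\<close> on \<open>V \<epsilon> n\<close>. The term \<open>V \<epsilon> 0 = f\<close> occurs only at \<open>j = n\<close> because \<open>gamma21\<close> maps it
  to \<open>0\<close>.
\<close>

definition V_orbit :: "complex \<Rightarrow> nat \<Rightarrow> nat \<Rightarrow> real \<Rightarrow> complex" where
  "V_orbit \<epsilon> n j x =
     (if j < n then \<epsilon> ^ j * V \<epsilon> (n - j) x
      else \<epsilon> ^ n * ((if j = n then V \<epsilon> 0 x else 0) - (gamma21 b q ^^ (j - n)) (\<lambda>x. 1) x))"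

lemma gamma21_lincomb:
  assumes "x \<in> {0..b}"
    and "\<And>t. t \<in> {0..b} \<Longrightarrow> g differentiable (at t within {0..b})"
    and "\<And>t. t \<in> {0..b} \<Longrightarrow> h differentiable (at t within {0..b})"
  shows "gamma21 b q (\<lambda>t. c * g t + d * h t) x = c * gamma21 b q g x + d * gamma21 b q h x"
proof -
  have "(if a then g else h) differentiable (at t within {0..b})" if "t \<in> {0..b}" for a t
    using assms(2,3)[OF that] by (cases a) simp_all
  then show ?thesis
    using gamma21_sum[OF b_pos q_cont assms(1) finite[of "UNIV :: bool set"],
        where g = "\<lambda>a. if a then g else h" and c = "\<lambda>a. if a then c else d"]
    by (simp add: UNIV_bool add.commute)
qed

lemma V_differentiable: "x \<in> {0..b} \<Longrightarrow> V \<epsilon> m differentiable (at x within {0..b})"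
  by (rule differentiableI_vector[OF V_deriv])

text \<open>
  A step from \<open>j\<close> with \<open>Suc j < N\<close> differentiates the iterate on \<open>1\<close> of index \<open>j - n \<le> N - 3\<close>, which
  is where the range of \<open>i\<close> comes from.
\<close>

lemma gamma21_orbit_V_orbit:
  assumes \<epsilon>: "\<epsilon>\<^sup>2 = 1" and n: "n \<ge> 1"
    and diff: "\<And>i x. i + 3 \<le> N \<Longrightarrow> x \<in> {0..b} \<Longrightarrow>
      (gamma21 b q ^^ i) (\<lambda>x. 1) differentiable (at x within {0..b})"
  shows "gamma21_orbit b q N (V_orbit \<epsilon> n)"
  unfolding gamma21_orbit_def
proof (intro allI impI)
  fix j x assume j: "Suc j < N" and x: "x \<in> {0..b}"
  show "V_orbit \<epsilon> n j differentiable (at x within {0..b}) \<and>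
        gamma21 b q (V_orbit \<epsilon> n j) x = V_orbit \<epsilon> n (Suc j) x"
  proof (cases "j < n")
    case True
    then obtain l where l: "n = Suc (j + l)" by (metis less_iff_Suc_add)
    \<comment> \<open>the vanishing summand only brings the function into the form of \<open>gamma21_lincomb\<close>\<close>
    have eq: "V_orbit \<epsilon> n j = (\<lambda>x. \<epsilon> ^ j * V \<epsilon> (Suc l) x + 0 * V \<epsilon> 0 x)"
      by (simp add: V_orbit_def[abs_def] l)
    show ?thesis unfolding eq
      using gamma21_lincomb[OF x V_differentiable V_differentiable, of "\<epsilon> ^ j" \<epsilon> "Suc l" 0 \<epsilon> 0] x
      by (auto simp: V_orbit_def gamma21_V[OF \<epsilon> x] l mult_ac
          intro!: differentiable_mult differentiable_const V_differentiable)
  next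
    case False
    let ?i = "j - n"
    have i: "?i + 3 \<le> N" using n False j by simp
    have eq: "V_orbit \<epsilon> n j = (\<lambda>x. (if j = n then \<epsilon> ^ n else 0) * V \<epsilon> 0 x
        + (- (\<epsilon> ^ n)) * (gamma21 b q ^^ ?i) (\<lambda>x. 1) x)"
      using False by (simp add: V_orbit_def[abs_def] fun_eq_iff algebra_simps)
    show ?thesis unfolding eq
      using gamma21_lincomb[OF x V_differentiable diff[OF i], of "if j = n then \<epsilon> ^ n else 0" \<epsilon> 0 "- (\<epsilon> ^ n)"] x False diff[OF i x]
      by (auto simp: V_orbit_def gamma21_V[OF \<epsilon> x] Suc_diff_le
          intro!: differentiable_add differentiable_mult differentiable_const differentiable_minus
            differentiable_diff V_differentiable)
  qed
qed

text \<open>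
  For \<open>j = n\<close> the function \<open>f\<close> is annihilated by \<open>gamma1\<close>, so the formula for \<open>j > n\<close> persists. The
  quotient of the iterate on \<open>1\<close> by \<open>f\<close> has to be differentiable only at \<open>0\<close>.
\<close>

lemma gamma1_V_orbit_at_0:
  assumes diff: "(\<lambda>x. (gamma21 b q ^^ (j - n)) (\<lambda>x. 1) x / f x) differentiable (at 0 within {0..b})
      \<or> j < n"
  shows "(\<lambda>x. V_orbit \<epsilon> n j x / f x) differentiable (at 0 within {0..b})"
    and "gamma1 b f (V_orbit \<epsilon> n j) 0 =
      (if j < n then if n = Suc j then \<epsilon> ^ j * (1 + \<epsilon>) else 0
       else - (\<epsilon> ^ n) * gamma1 b f ((gamma21 b q ^^ (j - n)) (\<lambda>x. 1)) 0)"
proof -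
  have 0: "0 \<in> {0..b}" using b_pos by simp
  note Vd = gamma1_of_derivative(1)[OF 0 V_deriv[OF 0]]
  define h where "h = (gamma21 b q ^^ (j - n)) (\<lambda>x. 1)"
  define g where "g a = (if a then V \<epsilon> (n - j) else h)" for a
  define c where "c a = (if a then if j < n then \<epsilon> ^ j else if j = n then \<epsilon> ^ n else 0 else - (\<epsilon> ^ n))" for a
  define S where "S = (if j < n then {True} else {True, False})"
  have eq: "V_orbit \<epsilon> n j t = (\<Sum>a\<in>S. c a * g a t)" for t
    by (auto simp: V_orbit_def S_def c_def g_def h_def algebra_simps)
  have gd: "(\<lambda>t. g a t / f t) differentiable (at 0 within {0..b})" if "a \<in> S" for a
    using that diff Vd by (auto simp: g_def h_def S_def split: if_splits)
  have "(\<lambda>t. \<Sum>a\<in>S. c a * (g a t / f t)) differentiable (at 0 within {0..b})"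
    by (intro differentiable_sum differentiable_mult differentiable_const ballI gd)
       (simp_all add: S_def)
  then show "(\<lambda>x. V_orbit \<epsilon> n j x / f x) differentiable (at 0 within {0..b})"
    by (simp add: eq sum_divide_distrib)
  have "gamma1 b f (V_orbit \<epsilon> n j) 0 = (\<Sum>a\<in>S. c a * gamma1 b f (g a) 0)"
    by (rule gamma1_sum[OF b_pos 0 eq gd])
  then show "gamma1 b f (V_orbit \<epsilon> n j) 0 =
      (if j < n then if n = Suc j then \<epsilon> ^ j * (1 + \<epsilon>) else 0
       else - (\<epsilon> ^ n) * gamma1 b f ((gamma21 b q ^^ (j - n)) (\<lambda>x. 1)) 0)"
    by (auto simp: S_def c_def g_def h_def gamma1_V_at_0)
qed

section \<open>Recovering the coefficients\<close>

text \<open>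
  Of the coefficients with \<open>n > j\<close> only \<open>n = j + 1\<close> survives, since \<open>gamma1\<close> detects only \<open>V \<epsilon> 1\<close> at \<open>0\<close>; those with
  \<open>n \<le> j\<close> contribute iterates on \<open>1\<close>, and for even \<open>n\<close> the two signs cancel.
\<close>

lemma gamma1_funpow_gamma21_s_poly:
  assumes j: "j < N"
    and diff: "\<And>i x. i + 3 \<le> N \<Longrightarrow> x \<in> {0..b} \<Longrightarrow>
      (gamma21 b q ^^ i) (\<lambda>x. 1) differentiable (at x within {0..b})"
    and diff0: "\<And>i. i + 2 \<le> N \<Longrightarrow>
      (\<lambda>x. (gamma21 b q ^^ i) (\<lambda>x. 1) x / f x) differentiable (at 0 within {0..b})"
  shows "gamma1 b f ((gamma21 b q ^^ j) (s_poly f N \<beta>)) 0 = \<beta> (Suc j) -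
    (\<Sum>n | n \<in> {1..j} \<and> odd n. \<beta> n * gamma1 b f ((gamma21 b q ^^ (j - n)) (\<lambda>x. 1)) 0)"
proof -
  have 0: "0 \<in> {0..b}" using b_pos by simp
  let ?G = "\<lambda>i. gamma1 b f ((gamma21 b q ^^ i) (\<lambda>x. 1)) 0"
  let ?w = "\<lambda>n j x. \<Sum>\<epsilon>\<in>{1,-1}. (\<epsilon> / 2) * V_orbit \<epsilon> n j x"
  let ?t = "\<lambda>j x. \<Sum>n\<in>{1..N}. \<beta> n * ?w n j x"
  have "gamma21_orbit b q N ?t"
    by (intro gamma21_orbit_sum b_pos q_cont gamma21_orbit_V_orbit diff) auto
  moreover have "s_poly f N \<beta> x = ?t 0 x" for x
    by (simp add: s_poly_def s_fun_eq_V V_orbit_def)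
  ultimately have it: "(gamma21 b q ^^ j) (s_poly f N \<beta>) x = ?t j x" if "x \<in> {0..b}" for x
    using b_pos j that by (intro funpow_gamma21_orbit) auto
  have d: "(\<lambda>x. V_orbit \<epsilon> n j x / f x) differentiable (at 0 within {0..b})"
    and v: "gamma1 b f (V_orbit \<epsilon> n j) 0 =
      (if j < n then if n = Suc j then \<epsilon> ^ j * (1 + \<epsilon>) else 0 else - (\<epsilon> ^ n) * ?G (j - n))"
    if "n \<ge> 1" for \<epsilon> n
  proof -
    have "(\<lambda>x. (gamma21 b q ^^ (j - n)) (\<lambda>x. 1) x / f x) differentiable (at 0 within {0..b}) \<or> j < n"
      using diff0[of "j - n"] that j by force
    from gamma1_V_orbit_at_0[OF this]
    show "(\<lambda>x. V_orbit \<epsilon> n j x / f x) differentiable (at 0 within {0..b})"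
      "gamma1 b f (V_orbit \<epsilon> n j) 0 =
      (if j < n then if n = Suc j then \<epsilon> ^ j * (1 + \<epsilon>) else 0 else - (\<epsilon> ^ n) * ?G (j - n))" .
  qed
  have wd: "(\<lambda>x. ?w n j x / f x) differentiable (at 0 within {0..b})" if "n \<ge> 1" for n
  proof -
    have "(\<lambda>x. \<Sum>\<epsilon>\<in>{1,-1}. (\<epsilon> / 2) * (V_orbit \<epsilon> n j x / f x)) differentiable (at 0 within {0..b})"
      by (intro differentiable_sum differentiable_mult differentiable_const ballI d that) simp_all
    then show ?thesis by (simp add: add_divide_distrib diff_divide_distrib)
  qed
  have "gamma1 b f (?w n j) 0 = (\<Sum>\<epsilon>\<in>{1,-1}. (\<epsilon> / 2) * gamma1 b f (V_orbit \<epsilon> n j) 0)"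
    if "n \<ge> 1" for n
    by (rule gamma1_sum[OF b_pos 0 refl d[OF that]])
  then have w: "gamma1 b f (?w n j) 0 = 
      (if n = Suc j then 1 else 0) - (if n \<in> {1..j} \<and> odd n then ?G (j - n) else 0)" if "n \<ge> 1" for n
    using that by (auto simp: v)
  have "gamma1 b f ((gamma21 b q ^^ j) (s_poly f N \<beta>)) 0 = (\<Sum>n\<in>{1..N}. \<beta> n * gamma1 b f (?w n j) 0)"
    by (rule gamma1_sum[OF b_pos 0 it wd]) auto
  also have "\<dots> = (\<Sum>n\<in>{1..N}. (if n = Suc j then \<beta> n else 0)
      - (if n \<in> {1..j} \<and> odd n then \<beta> n * ?G (j - n) else 0))"
    by (intro sum.cong refl, subst w) (auto simp: right_diff_distrib)
  also have "\<dots> = \<beta> (Suc j) - (\<Sum>n\<in>{1..N} \<inter> {n. n \<in> {1..j} \<and> odd n}. \<beta> n * ?G (j - n))"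
    using j by (simp add: sum_subtractf sum.inter_restrict)
  also have "{1..N} \<inter> {n. n \<in> {1..j} \<and> odd n} = {n. n \<in> {1..j} \<and> odd n}"
    using j by auto
  finally show ?thesis .
qed

end

theorem proposition4p6:
  fixes b :: real and q f :: "real \<Rightarrow> complex" and N :: nat and \<beta> :: "nat \<Rightarrow> complex"
  assumes "b > 0"
    and "continuous_on {0..b} q"
    and "schroedinger_solution b q f"
    and "f 0 = 1"
    and "\<forall>x\<in>{0..b}. f x \<noteq> 0"
    and "N \<ge> 1"
    and "\<forall>i. 1 \<le> i \<and> i + 2 \<le> N \<longrightarrow> q \<in> sobolev2 b (i - 1)"
    and "\<forall>i. i + 2 \<le> N \<longrightarrow>
           (\<lambda>x. (gamma21 b q ^^ i) (\<lambda>x. 1) x / f x) differentiable (at 0 within {0..b})"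
  shows "\<forall>c :: nat \<Rightarrow> complex.
           (\<forall>j\<in>{0..N-1}. c (j + 1) =
              gamma1 b f ((gamma21 b q ^^ j) (s_poly f N \<beta>)) 0 +
              (\<Sum>n | n \<in> {1..j} \<and> odd n.
                 c n * gamma1 b f ((gamma21 b q ^^ (j - n)) (\<lambda>x. 1)) 0))
           \<longleftrightarrow> (\<forall>n\<in>{1..N}. c n = \<beta> n)"
proof -
  from assms(3) obtain f' where
    "\<And>x. x \<in> {0..b} \<Longrightarrow> (f has_vector_derivative f' x) (at x within {0..b})"
    "\<And>x. x \<in> {0..b} \<Longrightarrow> (f' has_vector_derivative q x * f x) (at x within {0..b})"
    unfolding schroedinger_solution_def by blast
  with assms interpret nonvanishing_solution b q f f'
    by unfold_locales auto
  let ?G = "\<lambda>i. gamma1 b f ((gamma21 b q ^^ i) (\<lambda>x. 1)) 0"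
  \<comment> \<open>for \<open>N \<le> 4\<close> the truncated difference is \<open>0\<close> and continuity of \<open>q\<close> suffices\<close>
  have q: "cont_diff_on b (N - 4) q"
  proof (cases "N \<ge> 5")
    case True
    then have arith: "N - 2 - 1 = Suc (N - 4)" "1 \<le> N - 2" "N - 2 + 2 \<le> N" by auto
    have "q \<in> sobolev2 b (Suc (N - 4))"
      using assms(7)[rule_format, of "N - 2"] arith by (simp del: sobolev2.simps)
    then show ?thesis by (rule sobolev2_Suc_cont_diff_on)
  qed (use assms(2) in simp)
  have diff: "(gamma21 b q ^^ i) (\<lambda>x. 1) differentiable (at x within {0..b})"
    if "i + 3 \<le> N" "x \<in> {0..b}" for i x
  proof -
    have "cont_diff_on b (Suc 0) ((gamma21 b q ^^ i) (\<lambda>x. 1))"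
      using that(1) by (intro cont_diff_on_funpow_gamma21_1[OF b_pos q]) simp
    with that(2) show ?thesis by (auto intro: differentiableI_vector)
  qed
  have key: "gamma1 b f ((gamma21 b q ^^ j) (s_poly f N \<beta>)) 0 = \<beta> (Suc j) -
      (\<Sum>n | n \<in> {1..j} \<and> odd n. \<beta> n * ?G (j - n))" if "j < N" for j
    using that diff assms(8) by (intro gamma1_funpow_gamma21_s_poly) auto
  show ?thesis
  proof (intro allI iffI ballI)
    fix c :: "nat \<Rightarrow> complex" and n
    assume rel: "\<forall>j\<in>{0..N-1}. c (j + 1) =
        gamma1 b f ((gamma21 b q ^^ j) (s_poly f N \<beta>)) 0 +
        (\<Sum>n | n \<in> {1..j} \<and> odd n. c n * ?G (j - n))"
    assume "n \<in> {1..N}"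
    then show "c n = \<beta> n"
    proof (induction n rule: less_induct)
      case (less n)
      then obtain j where n: "n = Suc j" and j: "j < N" by (cases n) auto
      have "(\<Sum>n | n \<in> {1..j} \<and> odd n. c n * ?G (j - n)) =
          (\<Sum>n | n \<in> {1..j} \<and> odd n. \<beta> n * ?G (j - n))"
        using less.IH n j by (intro sum.cong) auto
      with rel key[OF j] j show ?case by (simp add: n)
    qed
  next
    fix c :: "nat \<Rightarrow> complex" and j
    assume eq: "\<forall>n\<in>{1..N}. c n = \<beta> n" and "j \<in> {0..N-1}"
    then have j: "j < N" using assms(6) by auto
    have "(\<Sum>n | n \<in> {1..j} \<and> odd n. c n * ?G (j - n)) =
        (\<Sum>n | n \<in> {1..j} \<and> odd n. \<beta> n * ?G (j - n))"
      using eq j by (intro sum.cong) auto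
    then show "c (j + 1) = gamma1 b f ((gamma21 b q ^^ j) (s_poly f N \<beta>)) 0 +
        (\<Sum>n | n \<in> {1..j} \<and> odd n. c n * ?G (j - n))"
      using key[OF j] eq j by simp
  qed
qed

end
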